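(* Let $A$ be a C*-algebra and $B\in[A]^\perp$ an annihilator. Then $B$ is central in the ortholattice $[A]^\perp$ if and only if $B$ is an ideal of $A$.
   Context: For $a,b\in A$ write $a\perp b$ if $ab=0=ab^*$, and for $S\subseteq A$ put $S^\perp=\{b\in A:s\perp b\text{ for all }s\in S\}$. An annihilator of $A$ is a set of the form $S^\perp$, $S\subseteq A$; $[A]^\perp$ is the set of annihilators. Ordered by inclusion, it is a complete ortholattice with infima given by intersection, $\bigvee\mathcal B=(\bigcup\mathcal B)^{\perp\perp}$ and orthocomplementation $B\mapsto B^\perp$. In an ortholattice, $s,t$ commute if both distributive laws $p\wedge(q\vee r)=(p\wedge q)\vee(p\wedge r)$ and $p\vee(q\wedge r)=(p\vee q)\wedge(p\vee r)$ hold for all $p,q,r\in\{s,s^\perp,t,t^\perp\}$; an element is central if it commutes with every element. Ideal means two-sided ideal. *)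

theory Defs
  imports "HOL-Analysis.Analysis" "HOL-Library.Complemented_Lattices"
begin

text \<open>
  The library has real Banach algebras only, so the complex scalars are added here in such a way
  that they extend the real ones. No unit is assumed, and the zero algebra is allowed.
\<close>

class cstar_algebra = real_normed_algebra + complete_space +
  fixes scaleC :: "complex \<Rightarrow> 'a \<Rightarrow> 'a"  (infixr "*\<^sub>C" 75)
    and star :: "'a \<Rightarrow> 'a"  ("_\<^sup>\<star>" [1000] 999)
  assumes scaleR_scaleC: "r *\<^sub>R x = complex_of_real r *\<^sub>C x"
    and scaleC_add_right: "c *\<^sub>C (x + y) = c *\<^sub>C x + c *\<^sub>C y"
    and scaleC_add_left: "(c + d) *\<^sub>C x = c *\<^sub>C x + d *\<^sub>C x"
    and scaleC_scaleC: "c *\<^sub>C d *\<^sub>C x = (c * d) *\<^sub>C x"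
    and scaleC_one: "1 *\<^sub>C x = x"
    and mult_scaleC_left: "(c *\<^sub>C x) * y = c *\<^sub>C (x * y)"
    and mult_scaleC_right: "x * (c *\<^sub>C y) = c *\<^sub>C (x * y)"
    and norm_scaleC: "norm (c *\<^sub>C x) = cmod c * norm x"
    and star_star: "(x\<^sup>\<star>)\<^sup>\<star> = x"
    and star_add: "(x + y)\<^sup>\<star> = x\<^sup>\<star> + y\<^sup>\<star>"
    and star_scaleC: "(c *\<^sub>C x)\<^sup>\<star> = cnj c *\<^sub>C x\<^sup>\<star>"
    and star_mult: "(x * y)\<^sup>\<star> = y\<^sup>\<star> * x\<^sup>\<star>"
    and norm_star_mult: "norm (x\<^sup>\<star> * x) = norm x ^ 2"

instantiation complex :: cstar_algebra
begin

definition scaleC_complex_def: "c *\<^sub>C (x::complex) = c * x"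

definition star_complex_def: "(x::complex)\<^sup>\<star> = cnj x"

instance
  by standard
    (simp_all add: scaleC_complex_def star_complex_def algebra_simps scaleR_conv_of_real
      norm_mult power2_eq_square)

end

definition two_sided_ideal :: "'a::cstar_algebra set \<Rightarrow> bool" where
  "two_sided_ideal I \<longleftrightarrow>
     0 \<in> I \<and>
     (\<forall>x\<in>I. \<forall>y\<in>I. x + y \<in> I) \<and>
     (\<forall>c. \<forall>x\<in>I. c *\<^sub>C x \<in> I) \<and>
     (\<forall>a. \<forall>x\<in>I. a * x \<in> I \<and> x * a \<in> I)"

lemma star_zero [simp]: "(0::'a::cstar_algebra)\<^sup>\<star> = 0"
  using star_add[of "0::'a" 0] by simp

lemma star_eq_zero_iff [simp]: "x\<^sup>\<star> = 0 \<longleftrightarrow> x = 0" for x :: "'a::cstar_algebra"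
  by (metis star_star star_zero)

lemma star_mult_self_eq_zero: "x\<^sup>\<star> * x = 0 \<Longrightarrow> x = 0" for x :: "'a::cstar_algebra"
  using norm_star_mult[of x] by simp

definition perp :: "'a::cstar_algebra \<Rightarrow> 'a \<Rightarrow> bool"  (infix "\<bottom>\<bottom>" 50) where
  "a \<bottom>\<bottom> b \<longleftrightarrow> a * b = 0 \<and> a * b\<^sup>\<star> = 0"

definition ann :: "'a::cstar_algebra set \<Rightarrow> 'a set" where
  "ann S = {b. \<forall>s\<in>S. s \<bottom>\<bottom> b}"

definition annihilators :: "'a::cstar_algebra set set" where
  "annihilators = range ann"

text \<open>
  The relation \<open>\<bottom>\<bottom>\<close> is not symmetric, and \<open>S \<subseteq> ann (ann S)\<close> may fail for
  arbitrary \<open>S\<close>. Both problems disappear for *-closed sets, and every annihilator is *-closed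
  and is the annihilator of a *-closed set.
\<close>

lemma ann_antimono: "S \<subseteq> T \<Longrightarrow> ann T \<subseteq> ann S"
  by (auto simp: ann_def)

lemma ann_in_annihilators [simp]: "ann S \<in> annihilators"
  by (simp add: annihilators_def)

lemma star_ann: "b \<in> ann S \<Longrightarrow> b\<^sup>\<star> \<in> ann S"
  by (auto simp: ann_def perp_def star_star)

lemma star_annihilators: "B \<in> annihilators \<Longrightarrow> b \<in> B \<Longrightarrow> b\<^sup>\<star> \<in> B"
  by (auto simp: annihilators_def star_ann)

lemma perp_sym_star:
  assumes "s \<bottom>\<bottom> b" "s\<^sup>\<star> \<bottom>\<bottom> b"
  shows "b \<bottom>\<bottom> s"
proof -
  have "(s\<^sup>\<star> * b\<^sup>\<star>)\<^sup>\<star> = 0" "(s * b\<^sup>\<star>)\<^sup>\<star> = 0"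
    using assms by (simp_all add: perp_def)
  then show ?thesis by (simp add: perp_def star_mult star_star)
qed

lemma subset_ann_ann:
  assumes "\<And>s. s \<in> S \<Longrightarrow> s\<^sup>\<star> \<in> S"
  shows "S \<subseteq> ann (ann S)"
proof
  fix s assume "s \<in> S"
  have "b \<bottom>\<bottom> s" if "b \<in> ann S" for b
    using \<open>s \<in> S\<close> assms[OF \<open>s \<in> S\<close>] that by (simp add: ann_def perp_sym_star)
  then show "s \<in> ann (ann S)" by (simp add: ann_def)
qed

lemma star_mult_self_mult_eq_zero:
  fixes s b :: "'a::cstar_algebra"
  assumes "s\<^sup>\<star> * s * b = 0"
  shows "s * b = 0"
proof -
  have "(s * b)\<^sup>\<star> * (s * b) = b\<^sup>\<star> * (s\<^sup>\<star> * s * b)"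
    by (simp add: star_mult mult.assoc)
  also have "\<dots> = 0" using assms by simp
  finally show ?thesis by (rule star_mult_self_eq_zero)
qed

lemma ann_eq_ann_star_mult_self: "ann S = ann ((\<lambda>s. s\<^sup>\<star> * s) ` S)"
proof -
  have "s\<^sup>\<star> * s * b = 0 \<longleftrightarrow> s * b = 0" for s b :: 'a
    using star_mult_self_mult_eq_zero[of s b] by (auto simp: mult.assoc)
  then show ?thesis by (simp add: ann_def perp_def)
qed

lemma ann_ann_annihilators:
  assumes "B \<in> annihilators"
  shows "ann (ann B) = B"
proof
  from assms obtain S where "B = ann S" by (auto simp: annihilators_def)
  define T where "T = (\<lambda>s. s\<^sup>\<star> * s) ` S"
  have B: "B = ann T"
    unfolding T_def \<open>B = ann S\<close> by (rule ann_eq_ann_star_mult_self)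
  have T: "t\<^sup>\<star> \<in> T" if "t \<in> T" for t
    using that by (auto simp: T_def star_mult star_star)
  from subset_ann_ann[OF T] show "ann (ann B) \<subseteq> B"
    unfolding B by (intro ann_antimono)
  show "B \<subseteq> ann (ann B)"
    using star_annihilators[OF assms] by (rule subset_ann_ann)
qed

lemma zero_in_annihilators: "B \<in> annihilators \<Longrightarrow> 0 \<in> B"
  by (auto simp: annihilators_def ann_def perp_def)

lemma Int_ann:
  assumes "B \<in> annihilators"
  shows "B \<inter> ann B = {0}"
proof -
  have "b = 0" if "b \<in> B" "b \<in> ann B" for b
  proof (rule star_mult_self_eq_zero)
    have "b\<^sup>\<star> \<in> B" using assms \<open>b \<in> B\<close> by (rule star_annihilators)
    then show "b\<^sup>\<star> * b = 0" using \<open>b \<in> ann B\<close> by (simp add: ann_def perp_def)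
  qed
  then show ?thesis using zero_in_annihilators assms ann_in_annihilators by blast
qed

lemma Inter_annihilators:
  assumes "\<B> \<subseteq> annihilators"
  shows "\<Inter>\<B> \<in> annihilators"
proof -
  have "\<Inter>\<B> = (\<Inter>B\<in>\<B>. ann (ann B))"
    using assms ann_ann_annihilators by auto
  also have "\<dots> = ann (\<Union>B\<in>\<B>. ann B)"
    by (auto simp: ann_def)
  finally show ?thesis by simp
qed

lemma Int_annihilators: "B \<in> annihilators \<Longrightarrow> C \<in> annihilators \<Longrightarrow> B \<inter> C \<in> annihilators"
  using Inter_annihilators[of "{B, C}"] by simp

lemma Union_subset_ann_ann: "\<B> \<subseteq> annihilators \<Longrightarrow> \<Union>\<B> \<subseteq> ann (ann (\<Union>\<B>))"
  by (intro subset_ann_ann) (auto dest: star_annihilators)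

lemma ann_ann_least: "S \<subseteq> B \<Longrightarrow> B \<in> annihilators \<Longrightarrow> ann (ann S) \<subseteq> B"
  by (metis ann_antimono ann_ann_annihilators)

lemma UNIV_annihilators: "UNIV \<in> annihilators"
proof -
  have "ann {} = (UNIV :: 'a set)" by (simp add: ann_def)
  then show ?thesis using ann_in_annihilators by metis
qed

lemma zero_annihilators: "{0} \<in> annihilators"
  using Int_ann[OF UNIV_annihilators] by (metis Int_UNIV_left ann_in_annihilators)

lemma ann_ann_empty: "ann (ann {}) = {0}"
proof
  show "ann (ann {}) \<subseteq> {0}" by (rule ann_ann_least[OF _ zero_annihilators]) simp
  show "{0} \<subseteq> ann (ann {})" using zero_in_annihilators[OF ann_in_annihilators] by simp
qed

typedef (overloaded) ('a::cstar_algebra) annihilator = "annihilators :: 'a set set"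
  using UNIV_annihilators by blast

setup_lifting type_definition_annihilator

instantiation annihilator :: (cstar_algebra) "{complete_lattice, orthocomplemented_lattice}"
begin

lift_definition less_eq_annihilator :: "'a annihilator \<Rightarrow> 'a annihilator \<Rightarrow> bool" is "(\<subseteq>)" .

lift_definition less_annihilator :: "'a annihilator \<Rightarrow> 'a annihilator \<Rightarrow> bool" is "(\<subset>)" .

lift_definition Inf_annihilator :: "'a annihilator set \<Rightarrow> 'a annihilator" is "\<lambda>\<B>. \<Inter>\<B>"
  by (blast intro: Inter_annihilators)

lift_definition Sup_annihilator :: "'a annihilator set \<Rightarrow> 'a annihilator"
  is "\<lambda>\<B>. ann (ann (\<Union>\<B>))"
  by simp

lift_definition inf_annihilator :: "'a annihilator \<Rightarrow> 'a annihilator \<Rightarrow> 'a annihilator"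
  is "(\<inter>)"
  by (rule Int_annihilators)

lift_definition sup_annihilator :: "'a annihilator \<Rightarrow> 'a annihilator \<Rightarrow> 'a annihilator"
  is "\<lambda>B C. ann (ann (B \<union> C))"
  by simp

lift_definition bot_annihilator :: "'a annihilator" is "{0}"
  by (rule zero_annihilators)

lift_definition top_annihilator :: "'a annihilator" is UNIV
  by (rule UNIV_annihilators)

lift_definition uminus_annihilator :: "'a annihilator \<Rightarrow> 'a annihilator" is ann
  by simp

definition minus_annihilator :: "'a annihilator \<Rightarrow> 'a annihilator \<Rightarrow> 'a annihilator" where
  "minus_annihilator B C = inf B (- C)"

instance
proof
  fix B C D :: "'a annihilator" and \<B> :: "'a annihilator set"
  show "B < C \<longleftrightarrow> B \<le> C \<and> \<not> C \<le> B" by transfer blast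
  show "B \<le> B" by transfer blast
  show "B \<le> C \<Longrightarrow> C \<le> D \<Longrightarrow> B \<le> D" by transfer blast
  show "B \<le> C \<Longrightarrow> C \<le> B \<Longrightarrow> B = C" by transfer blast
  show "inf B C \<le> B" by transfer blast
  show "inf B C \<le> C" by transfer blast
  show "B \<le> C \<Longrightarrow> B \<le> D \<Longrightarrow> B \<le> inf C D" by transfer blast
  show "B \<le> sup B C" by transfer (use Union_subset_ann_ann[of "{B, C}" for B C] in auto)
  show "C \<le> sup B C" by transfer (use Union_subset_ann_ann[of "{B, C}" for B C] in auto)
  show "C \<le> B \<Longrightarrow> D \<le> B \<Longrightarrow> sup C D \<le> B" by transfer (simp add: ann_ann_least)
  show "Inf \<B> \<le> B" if "B \<in> \<B>" using that by transfer blast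
  show "B \<le> Inf \<B>" if "\<And>C. C \<in> \<B> \<Longrightarrow> B \<le> C" using that by transfer blast
  show "B \<le> Sup \<B>" if "B \<in> \<B>"
    using that by transfer (rule order_trans[OF Union_upper Union_subset_ann_ann], blast+)
  show "Sup \<B> \<le> B" if "\<And>C. C \<in> \<B> \<Longrightarrow> C \<le> B"
    using that by transfer (rule ann_ann_least[OF Union_least], blast+)
  show "Inf {} = (top :: 'a annihilator)" by transfer simp
  show "Sup {} = (bot :: 'a annihilator)"
    by transfer (simp add: ann_ann_empty)
  show "bot \<le> B" by transfer (simp add: zero_in_annihilators)
  show "B \<le> top" by transfer simp
  show "inf B (- B) = bot" by transfer (rule Int_ann)
  show "- (- B) = B" by transfer (rule ann_ann_annihilators)
  show "B \<le> C \<Longrightarrow> - C \<le> - B" by transfer (rule ann_antimono)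
  show "sup B (- B) = top"
  proof transfer
    fix B :: "'a set"
    assume B: "B \<in> annihilators"
    have "ann (B \<union> ann B) = ann B \<inter> ann (ann B)" by (auto simp: ann_def)
    also have "\<dots> = {0}" by (rule Int_ann) simp
    finally show "ann (ann (B \<union> ann B)) = UNIV"
      by (auto simp: ann_def perp_def)
  qed
  show "B - C = inf B (- C)" by (rule minus_annihilator_def)
qed

end

definition ortho_commute :: "'l::orthocomplemented_lattice \<Rightarrow> 'l \<Rightarrow> bool" where
  "ortho_commute s t \<longleftrightarrow>
     (\<forall>p \<in> {s, - s, t, - t}. \<forall>q \<in> {s, - s, t, - t}. \<forall>r \<in> {s, - s, t, - t}.
        inf p (sup q r) = sup (inf p q) (inf p r) \<and>
        sup p (inf q r) = inf (sup p q) (sup p r))"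

definition ortho_central :: "'l::orthocomplemented_lattice \<Rightarrow> bool" where
  "ortho_central s \<longleftrightarrow> (\<forall>t. ortho_commute s t)"

end

theory Submission
  imports Defs
begin

text \<open>
  Both conditions on \<open>B\<close> are compared with the splitting property
  \<open>T = (T \<inter> B) \<or> (T \<inter> B\<^sup>\<bottom>)\<close> for every annihilator \<open>T\<close>.

  Centrality is equivalent to splitting in every ortholattice (\<open>ortho_central_iff_splits\<close>).
  Splitting is assumed for all elements at once, hence also for complements, and its dual form takes
  the place of the orthomodular law in the derivation of the distributive laws.

  If \<open>B\<close> is an ideal, then so is \<open>B\<^sup>\<bottom>\<close>. Annihilators are hereditary, so \<open>t\<^sup>\<star> d\<^sup>\<star> d t\<close> lies in
  \<open>T \<inter> B\<close> for \<open>t \<in> T\<close> and \<open>d \<in> B\<close>. An \<open>x\<close> that annihilates \<open>T \<inter> B\<close> therefore satisfies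
  \<open>B t x = 0\<close>, and likewise \<open>B\<^sup>\<bottom> t x = 0\<close> if it annihilates \<open>T \<inter> B\<^sup>\<bottom>\<close>. Hence \<open>t x\<close> lies in
  \<open>B\<^sup>\<bottom> \<inter> B\<^sup>\<bottom>\<^sup>\<bottom> = {0}\<close> (\<open>ideal_splits\<close>).

  Conversely, \<open>B\<close> is an ideal as soon as \<open>b a c = 0\<close> for \<open>b \<in> B\<close>, \<open>c \<in> B\<^sup>\<bottom>\<close> and all \<open>a\<close>.
  The element \<open>x = b a c\<close> behaves like an off-diagonal matrix unit that maps the \<open>B\<^sup>\<bottom>\<close> corner to
  the \<open>B\<close> corner. Its graph is the range of \<open>z = x + x\<^sup>\<star> x\<close>, a line that meets neither
  coordinate axis: the annihilator \<open>T\<close> generated by \<open>z z\<^sup>\<star>\<close> has zero intersection with \<open>B\<close> and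
  with \<open>B\<^sup>\<bottom>\<close>. Splitting of \<open>T\<close> yields \<open>T = {0}\<close>, so \<open>z = 0\<close> and \<open>x = 0\<close>
  (\<open>splits_imp_corner_zero\<close>).
\<close>

section \<open>Central elements of ortholattices\<close>

context
  fixes s :: "'l::orthocomplemented_lattice"
  assumes splits: "\<And>t. t \<le> sup (inf t s) (inf t (- s))"
begin

text \<open>
  This is where splitting of a complement replaces the orthomodular law: since \<open>- s \<le> - u\<close>,
  splitting of \<open>- u\<close> reads \<open>- u = sup (inf (- u) s) (- s)\<close>, and the claim is the complement of a
  consequence of this identity.
\<close>

lemma splits_inf_sup_le:
  assumes "u \<le> s" "v \<le> - s"
  shows "inf s (sup u v) \<le> u"
proof -
  have "s \<le> - v"
    using compl_mono[OF assms(2)] by simp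
  have "- u \<le> sup (inf (- u) s) (inf (- u) (- s))"
    by (rule splits)
  also have "\<dots> \<le> sup (- s) (inf (- u) (- v))"
    using inf_mono[OF order_refl \<open>s \<le> - v\<close>, of "- u"] by (simp add: le_supI1 le_supI2)
  finally have "- sup (- s) (inf (- u) (- v)) \<le> - (- u)"
    by (rule compl_mono)
  then show ?thesis
    by (simp add: compl_sup compl_inf)
qed

lemma splits_inf_sup_distrib:
  "inf s (sup q r) = sup (inf s q) (inf s r)"
proof (rule order.antisym)
  define u where "u = sup (inf s q) (inf s r)"
  define v where "v = sup (inf (- s) q) (inf (- s) r)"
  have "q \<le> sup u v" "r \<le> sup u v"
    using splits[of q] splits[of r] unfolding u_def v_def inf_commute[of s] inf_commute[of "- s"]
    by (blast intro: order_trans sup_mono sup_ge1 sup_ge2)+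
  then have "inf s (sup q r) \<le> inf s (sup u v)"
    by (intro inf_mono order_refl le_supI)
  also have "\<dots> \<le> u"
    by (rule splits_inf_sup_le) (simp_all add: u_def v_def)
  finally show "inf s (sup q r) \<le> sup (inf s q) (inf s r)"
    by (simp add: u_def)
qed (intro le_supI inf_mono order_refl sup_ge1 sup_ge2)

end

text \<open>
  The hypothesis of the preceding lemmas is invariant under \<open>s \<mapsto> - s\<close>, so \<open>inf (- s)\<close>
  distributes over suprema as well. Splitting the left side along \<open>s\<close> then gives the pieces
  \<open>inf t s\<close> and \<open>inf (inf t r) (- s)\<close>.
\<close>

lemma splits_inf_sup_distrib':
  fixes s :: "'l::orthocomplemented_lattice"
  assumes splits: "\<And>t. t \<le> sup (inf t s) (inf t (- s))"
  shows "inf t (sup s r) = sup (inf t s) (inf t r)"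
proof (rule order.antisym)
  have "inf (- s) (sup s r) = sup (inf (- s) s) (inf (- s) r)"
    by (rule splits_inf_sup_distrib) (use splits in \<open>simp add: sup_commute\<close>)
  then have le: "inf (- s) (sup s r) \<le> r"
    by (simp add: inf_commute[of "- s" s])
  have "inf t (sup s r) \<le> sup (inf (inf t (sup s r)) s) (inf (inf t (sup s r)) (- s))"
    by (rule splits)
  also have "\<dots> \<le> sup (inf t s) (inf t r)"
  proof (rule sup_mono)
    show "inf (inf t (sup s r)) s \<le> inf t s"
      by (intro inf_mono order_refl inf_le1)
    show "inf (inf t (sup s r)) (- s) \<le> inf t r"
      using inf_mono[OF order_refl le, of t] by (simp add: inf_assoc inf_commute[of "- s"])
  qed
  finally show "inf t (sup s r) \<le> sup (inf t s) (inf t r)" .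
qed (intro le_supI inf_mono order_refl sup_ge1 sup_ge2)

theorem ortho_central_iff_splits:
  fixes s :: "'l::orthocomplemented_lattice"
  shows "ortho_central s \<longleftrightarrow> (\<forall>t. t \<le> sup (inf t s) (inf t (- s)))"
proof
  assume central: "ortho_central s"
  show "\<forall>t. t \<le> sup (inf t s) (inf t (- s))"
  proof
    fix t
    have "inf t (sup s (- s)) = sup (inf t s) (inf t (- s))"
      using central unfolding ortho_central_def ortho_commute_def by blast
    then show "t \<le> sup (inf t s) (inf t (- s))"
      by simp
  qed
next
  assume splits: "\<forall>t. t \<le> sup (inf t s) (inf t (- s))"
  then have splits': "\<forall>t. t \<le> sup (inf t (- s)) (inf t (- (- s)))"
    by (simp add: sup_commute)
  show "ortho_central s"
    unfolding ortho_central_def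
  proof
    fix t
    define X where "X = {s, - s, t, - t}"
    have inf_sup: "inf p (sup q r) = sup (inf p q) (inf p r)"
      if "p \<in> X" "q \<in> X" "r \<in> X" for p q r
    proof -
      have s: "inf s (sup q r) = sup (inf s q) (inf s r)"
        "inf (- s) (sup q r) = sup (inf (- s) q) (inf (- s) r)" for q r
        using splits_inf_sup_distrib[of s] splits_inf_sup_distrib[of "- s"] splits splits' by blast+
      have s': "inf p (sup s r) = sup (inf p s) (inf p r)"
        "inf p (sup (- s) r) = sup (inf p (- s)) (inf p r)" for p r
        using splits_inf_sup_distrib'[of s] splits_inf_sup_distrib'[of "- s"] splits splits' by blast+
      have s'': "inf p (sup r s) = sup (inf p r) (inf p s)"
        "inf p (sup r (- s)) = sup (inf p r) (inf p (- s))" for p r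
        using s'[of p r] by (simp_all add: sup_commute)
      show ?thesis
      proof (cases "p \<in> {s, - s} \<or> q \<in> {s, - s} \<or> r \<in> {s, - s}")
        case True
        then show ?thesis using s s' s'' by (elim disjE insertE emptyE; simp only:)
      next
        case False
        then have "p \<in> {t, - t}" "q \<in> {t, - t}" "r \<in> {t, - t}"
          using that by (simp_all add: X_def)
        then show ?thesis
          by (elim insertE emptyE; simp)
      qed
    qed
    \<comment> \<open>The set \<open>X\<close> is closed under complements, so the second law follows by De Morgan.\<close>
    have sup_inf: "sup p (inf q r) = inf (sup p q) (sup p r)"
      if "p \<in> X" "q \<in> X" "r \<in> X" for p q r
    proof -
      have "- p \<in> X" "- q \<in> X" "- r \<in> X"
        using that by (auto simp: X_def)
      from arg_cong[OF inf_sup[OF this], of uminus] show ?thesis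
        by (simp add: compl_sup compl_inf)
    qed
    show "ortho_commute s t"
      unfolding ortho_commute_def X_def[symmetric] using inf_sup sup_inf by blast
  qed
qed

section \<open>Annihilators in C*-algebras\<close>

lemma star_diff: "(x - y)\<^sup>\<star> = x\<^sup>\<star> - y\<^sup>\<star>" for x y :: "'a::cstar_algebra"
  by (metis add_diff_cancel diff_add_cancel star_add)

lemma ann_mult_eq_zero:
  assumes "B \<in> annihilators" "b \<in> B" "c \<in> ann B"
  shows "b * c = 0" "c * b = 0"
proof -
  show "b * c = 0"
    using assms by (simp add: ann_def perp_def)
  have "b \<in> ann (ann B)"
    using assms by (simp add: ann_ann_annihilators)
  then show "c * b = 0"
    using assms by (simp add: ann_def perp_def)
qed

lemma annihilatorI:
  assumes "B \<in> annihilators" "\<And>c. c \<in> ann B \<Longrightarrow> c * b = 0" "\<And>c. c \<in> ann B \<Longrightarrow> c * b\<^sup>\<star> = 0"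
  shows "b \<in> B"
proof -
  have "b \<in> ann (ann B)"
    using assms by (simp add: ann_def perp_def)
  then show ?thesis
    using assms by (simp add: ann_ann_annihilators)
qed

lemma annihilator_hereditary:
  assumes "T \<in> annihilators" "t \<in> T" "t' \<in> T"
  shows "t * a * t' \<in> T"
proof (rule annihilatorI[OF assms(1)])
  fix c assume c: "c \<in> ann T"
  have "c * t = 0" "c * t'\<^sup>\<star> = 0"
    using ann_mult_eq_zero(2) star_annihilators assms c by blast+
  then show "c * (t * a * t') = 0" "c * (t * a * t')\<^sup>\<star> = 0"
    by (simp_all add: star_mult flip: mult.assoc)
qed

lemma annihilator_add:
  assumes "B \<in> annihilators" "x \<in> B" "y \<in> B"
  shows "x + y \<in> B"
proof -
  obtain S where "B = ann S"
    using assms(1) by (auto simp: annihilators_def)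
  with assms(2,3) show ?thesis
    by (simp add: ann_def perp_def star_add distrib_left)
qed

lemma annihilator_scaleC:
  assumes "B \<in> annihilators" "x \<in> B"
  shows "c *\<^sub>C x \<in> B"
proof -
  obtain S where "B = ann S"
    using assms(1) by (auto simp: annihilators_def)
  have "d *\<^sub>C 0 = (0::'a)" for d
    using scaleC_add_right[of d "0::'a" 0] by simp
  with assms(2) \<open>B = ann S\<close> show ?thesis
    by (simp add: ann_def perp_def star_scaleC mult_scaleC_right)
qed

lemma annihilator_ideal_iff:
  assumes "B \<in> annihilators"
  shows "two_sided_ideal B \<longleftrightarrow> (\<forall>a. \<forall>b\<in>B. a * b \<in> B)"
proof
  assume left: "\<forall>a. \<forall>b\<in>B. a * b \<in> B"
  have "b * a \<in> B" if "b \<in> B" for a b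
  proof -
    have "a\<^sup>\<star> * b\<^sup>\<star> \<in> B"
      using left star_annihilators[OF assms that] by blast
    from star_annihilators[OF assms this] show ?thesis
      by (simp add: star_mult star_star)
  qed
  then show "two_sided_ideal B"
    using left annihilator_add annihilator_scaleC zero_in_annihilators assms
    unfolding two_sided_ideal_def by blast
qed (auto simp: two_sided_ideal_def)

section \<open>Ideals split every annihilator\<close>

lemma two_sided_ideal_ann:
  assumes "two_sided_ideal B"
  shows "two_sided_ideal (ann B)"
proof -
  have "a * c \<in> ann B" if "c \<in> ann B" for a c
  proof -
    have "b * (a * c) = 0" "b * (a * c)\<^sup>\<star> = 0" if "b \<in> B" for b
    proof -
      have "(b * a) * c = 0" "b * c\<^sup>\<star> = 0"
        using assms \<open>b \<in> B\<close> \<open>c \<in> ann B\<close>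
        unfolding two_sided_ideal_def ann_def perp_def by blast+
      then show "b * (a * c) = 0" "b * (a * c)\<^sup>\<star> = 0"
        by (simp_all add: star_mult flip: mult.assoc)
    qed
    then show ?thesis by (simp add: ann_def perp_def)
  qed
  then show ?thesis by (simp add: annihilator_ideal_iff)
qed

text \<open>
  The relation \<open>perp\<close> also demands \<open>b y\<^sup>\<star> = 0\<close>. This comes for free over an ideal: \<open>e = y b\<^sup>\<star>\<close>
  lies in \<open>B\<close>, so \<open>e\<^sup>\<star> e = (e\<^sup>\<star> y) b\<^sup>\<star> = 0\<close>.
\<close>

lemma ideal_annI:
  assumes "B \<in> annihilators" "two_sided_ideal B" "\<And>b. b \<in> B \<Longrightarrow> b * y = 0"
  shows "y \<in> ann B"
proof -
  have "b * y\<^sup>\<star> = 0" if "b \<in> B" for b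
  proof -
    define e where "e = y * b\<^sup>\<star>"
    have "e \<in> B"
      using assms(2) star_annihilators[OF assms(1) that] by (simp add: e_def two_sided_ideal_def)
    then have "e\<^sup>\<star> * y = 0"
      using assms(3) star_annihilators[OF assms(1)] by blast
    then have "e\<^sup>\<star> * e = 0"
      by (simp add: e_def flip: mult.assoc)
    then have "e = 0"
      by (rule star_mult_self_eq_zero)
    moreover have "e\<^sup>\<star> = b * y\<^sup>\<star>"
      by (simp add: e_def star_mult star_star)
    ultimately show ?thesis
      by simp
  qed
  with assms(3) show ?thesis
    by (simp add: ann_def perp_def)
qed

text \<open>
  For \<open>d \<in> I\<close> the element \<open>t\<^sup>\<star> d\<^sup>\<star> d t\<close> lies in \<open>T\<close> by heredity and in \<open>I\<close> by the ideal property,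
  so \<open>(d t x)\<^sup>\<star> (d t x) = 0\<close>.
\<close>

lemma ideal_mult_in_ann:
  assumes "T \<in> annihilators" "I \<in> annihilators" "two_sided_ideal I" "t \<in> T"
    and "\<And>u. u \<in> T \<inter> I \<Longrightarrow> u * x = 0"
  shows "t * x \<in> ann I"
proof (rule ideal_annI[OF assms(2,3)])
  fix d assume "d \<in> I"
  have "t\<^sup>\<star> * (d\<^sup>\<star> * d) * t \<in> T"
    using annihilator_hereditary star_annihilators assms(1,4) by blast
  moreover have "t\<^sup>\<star> * (d\<^sup>\<star> * d) * t \<in> I"
    using assms(3) \<open>d \<in> I\<close> by (simp add: two_sided_ideal_def)
  ultimately have "t\<^sup>\<star> * (d\<^sup>\<star> * d) * t * x = 0"
    using assms(5) by blast
  then have "(d * (t * x))\<^sup>\<star> * (d * (t * x)) = 0"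
    by (simp add: star_mult mult.assoc)
  then show "d * (t * x) = 0"
    by (rule star_mult_self_eq_zero)
qed

lemma ideal_splits:
  assumes T: "T \<in> annihilators" and B: "B \<in> annihilators" "two_sided_ideal B"
  shows "T \<subseteq> ann (ann ((T \<inter> B) \<union> (T \<inter> ann B)))"
proof -
  define U where "U = (T \<inter> B) \<union> (T \<inter> ann B)"
  have zero: "t * x = 0" if "t \<in> T" "x \<in> ann U" for t x
  proof -
    have U: "u * x = 0" if "u \<in> U" for u
      using \<open>x \<in> ann U\<close> that unfolding ann_def perp_def by blast
    have "t * x \<in> ann B"
      by (rule ideal_mult_in_ann[OF T B \<open>t \<in> T\<close>]) (rule U, simp add: U_def)
    moreover have "t * x \<in> ann (ann B)"
      by (rule ideal_mult_in_ann[OF T ann_in_annihilators two_sided_ideal_ann[OF B(2)] \<open>t \<in> T\<close>])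
        (rule U, simp add: U_def)
    ultimately show ?thesis
      using Int_ann[OF ann_in_annihilators[of B]] by blast
  qed
  have "x \<bottom>\<bottom> t" if "t \<in> T" "x \<in> ann U" for t x
  proof (rule perp_sym_star)
    show "t \<bottom>\<bottom> x" "t\<^sup>\<star> \<bottom>\<bottom> x"
      using zero that star_annihilators[OF T that(1)] star_ann[OF that(2)]
      by (simp_all add: perp_def)
  qed
  then have "T \<subseteq> ann (ann U)"
    unfolding ann_def[of "ann U"] by blast
  then show ?thesis
    by (simp only: U_def)
qed

section \<open>The graph of an off-diagonal element\<close>

text \<open>
  The last two hypotheses put \<open>t\<close> into \<open>ann {z z\<^sup>\<star>}\<close>, which meets its own annihilator only in \<open>0\<close>.
\<close>

lemma generated_annihilator_eq_zero:
  fixes z :: "'a::cstar_algebra"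
  assumes "t \<in> ann (ann {z * z\<^sup>\<star>})" "z\<^sup>\<star> * t = 0" "z\<^sup>\<star> * t\<^sup>\<star> = 0"
  shows "t = 0"
proof -
  have "t \<in> ann {z * z\<^sup>\<star>}"
    using assms by (simp add: ann_def perp_def mult.assoc)
  then show ?thesis
    using assms(1) Int_ann[OF ann_in_annihilators[of "{z * z\<^sup>\<star>}"]] by blast
qed

text \<open>
  The condition \<open>x\<^sup>2 = 0\<close> makes \<open>x\<close> a \<open>2 \<times> 2\<close> matrix with one off-diagonal entry, and
  \<open>z = x + x\<^sup>\<star> x\<close> the column \<open>(x, x\<^sup>\<star> x)\<close>. A column orthogonal to it is \<open>(x x\<^sup>\<star>, - x\<^sup>\<star>)\<close>, that is
  \<open>w = x x\<^sup>\<star> - x\<^sup>\<star>\<close>. Elements \<open>t\<close> of the annihilator generated by \<open>z z\<^sup>\<star>\<close> are killed by \<open>w\<^sup>\<star>\<close>,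
  so \<open>x x\<^sup>\<star> t = x t\<close>.
\<close>

lemma graph_annihilator:
  fixes x :: "'a::cstar_algebra"
  assumes sq: "x * x = 0" and t: "t \<in> ann (ann {(x + x\<^sup>\<star> * x) * (x + x\<^sup>\<star> * x)\<^sup>\<star>})"
  shows "x * x\<^sup>\<star> * t = x * t"
proof -
  define z where "z = x + x\<^sup>\<star> * x"
  define w where "w = x * x\<^sup>\<star> - x\<^sup>\<star>"
  have sq': "x\<^sup>\<star> * x\<^sup>\<star> = 0"
    using arg_cong[OF sq, of star] by (simp add: star_mult)
  have w_star: "w\<^sup>\<star> = x * x\<^sup>\<star> - x"
    by (simp add: w_def star_diff star_mult star_star)
  have "x * x\<^sup>\<star> * (x\<^sup>\<star> * x) = x * (x\<^sup>\<star> * x\<^sup>\<star>) * x"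
    by (simp add: mult.assoc)
  then have "w\<^sup>\<star> * z = 0"
    unfolding w_star z_def by (simp add: sq sq' algebra_simps flip: mult.assoc)
  then have "z\<^sup>\<star> * w = 0"
    using star_mult[of "w\<^sup>\<star>" z] by (simp add: star_star)
  then have "z * z\<^sup>\<star> * (w * w\<^sup>\<star>) = 0"
    by (metis mult.assoc mult_zero_left mult_zero_right)
  then have "w * w\<^sup>\<star> \<in> ann {z * z\<^sup>\<star>}"
    by (simp add: ann_def perp_def star_mult star_star)
  with t have "w * w\<^sup>\<star> * t = 0"
    by (simp add: ann_def perp_def z_def)
  then have "w\<^sup>\<star> * t = 0"
    using star_mult_self_mult_eq_zero[of "w\<^sup>\<star>" t] by (simp add: star_star)
  then show ?thesis
    by (simp add: w_star algebra_simps)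
qed

text \<open>
  If \<open>x = b a c\<close> were nonzero, the annihilator generated by its graph would be nonzero and yet meet
  both \<open>B\<close> and \<open>ann B\<close> only in \<open>0\<close>, so it could not split.
\<close>

lemma splits_imp_corner_zero:
  assumes B: "B \<in> annihilators"
    and splits: "\<And>T. T \<in> annihilators \<Longrightarrow> T \<subseteq> ann (ann ((T \<inter> B) \<union> (T \<inter> ann B)))"
    and b: "b \<in> B" and c: "c \<in> ann B"
  shows "b * a * c = 0"
proof -
  define x where "x = b * a * c"
  define z where "z = x + x\<^sup>\<star> * x"
  define T where "T = ann (ann {z * z\<^sup>\<star>})"
  have T: "T \<in> annihilators"
    by (simp add: T_def)
  have xB: "x * t = 0" if "t \<in> B" for t
    using ann_mult_eq_zero(2)[OF B that c] by (simp add: x_def mult.assoc)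
  have xC: "x\<^sup>\<star> * t = 0" if "t \<in> ann B" for t
    using ann_mult_eq_zero(1)[OF B star_annihilators[OF B b] that]
    by (simp add: x_def star_mult mult.assoc)
  have sq: "x * x = 0"
    using xB[OF b] by (simp add: x_def flip: mult.assoc)
  have graph: "x * x\<^sup>\<star> * t = x * t" if "t \<in> T" for t
    using graph_annihilator[OF sq] that by (simp add: T_def z_def)
  have z_star: "z\<^sup>\<star> * t = x\<^sup>\<star> * t + x\<^sup>\<star> * (x * t)" for t
    by (simp add: z_def star_add star_mult star_star algebra_simps)
  \<comment> \<open>On either axis one of \<open>x t\<close> and \<open>x\<^sup>\<star> t\<close> vanishes, and the graph relation kills the other.\<close>
  have z_zero: "z\<^sup>\<star> * t = 0" if "t \<in> (T \<inter> B) \<union> (T \<inter> ann B)" for t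
    using that
  proof
    assume t: "t \<in> T \<inter> B"
    then have "x * x\<^sup>\<star> * t = 0"
      using graph xB by auto
    then have "x\<^sup>\<star> * t = 0"
      using star_mult_self_mult_eq_zero[of "x\<^sup>\<star>" t] by (simp add: star_star)
    then show ?thesis
      using t xB by (simp add: z_star)
  next
    assume t: "t \<in> T \<inter> ann B"
    then have "x * t = 0"
      using graph[of t] xC by (simp add: mult.assoc)
    then show ?thesis
      using t xC by (simp add: z_star)
  qed
  have "t = 0" if t: "t \<in> (T \<inter> B) \<union> (T \<inter> ann B)" for t
  proof (rule generated_annihilator_eq_zero)
    show "t \<in> ann (ann {z * z\<^sup>\<star>})"
      using t by (auto simp: T_def)
    have "t\<^sup>\<star> \<in> (T \<inter> B) \<union> (T \<inter> ann B)"
      using t star_annihilators[OF T] star_annihilators[OF B] star_ann by blast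
    with t show "z\<^sup>\<star> * t = 0" "z\<^sup>\<star> * t\<^sup>\<star> = 0"
      using z_zero by blast+
  qed
  then have "(T \<inter> B) \<union> (T \<inter> ann B) \<subseteq> {0}"
    by blast
  then have "T \<subseteq> {0}"
    using splits[OF T] ann_ann_least[OF _ zero_annihilators] by blast
  moreover have "z * z\<^sup>\<star> \<in> T"
    using subset_ann_ann[of "{z * z\<^sup>\<star>}"] by (simp add: T_def star_mult star_star)
  ultimately have "z = 0"
    using star_mult_self_eq_zero[of "z\<^sup>\<star>"] by (auto simp: star_star)
  have "x\<^sup>\<star> * x\<^sup>\<star> = 0"
    using arg_cong[OF sq, of star] by (simp add: star_mult)
  then have "x\<^sup>\<star> * z = x\<^sup>\<star> * x"
    by (simp add: z_def distrib_left flip: mult.assoc)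
  with \<open>z = 0\<close> have "x\<^sup>\<star> * x = 0"
    by simp
  then have "x = 0"
    by (rule star_mult_self_eq_zero)
  then show ?thesis
    by (simp add: x_def)
qed

text \<open>
  By the double annihilator property, \<open>a b \<in> B\<close> amounts to \<open>c a b = 0\<close> and \<open>c b\<^sup>\<star> a\<^sup>\<star> = 0\<close> for
  \<open>c \<in> ann B\<close>. The first product is the adjoint of \<open>b\<^sup>\<star> a\<^sup>\<star> c\<^sup>\<star>\<close>, and \<open>c b\<^sup>\<star> = 0\<close> settles the second.
\<close>

lemma splits_imp_ideal:
  assumes B: "B \<in> annihilators"
    and splits: "\<And>T. T \<in> annihilators \<Longrightarrow> T \<subseteq> ann (ann ((T \<inter> B) \<union> (T \<inter> ann B)))"
  shows "two_sided_ideal B"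
  unfolding annihilator_ideal_iff[OF B]
proof (intro allI ballI)
  fix a b assume b: "b \<in> B"
  show "a * b \<in> B"
  proof (rule annihilatorI[OF B])
    fix c assume c: "c \<in> ann B"
    have "b\<^sup>\<star> * a\<^sup>\<star> * c\<^sup>\<star> = 0"
      using splits_imp_corner_zero[OF B splits] star_annihilators[OF B b] star_ann[OF c] by blast
    then have "(c * (a * b))\<^sup>\<star> = 0"
      by (simp add: star_mult)
    then show "c * (a * b) = 0"
      by simp
    have "c * b\<^sup>\<star> = 0"
      by (rule ann_mult_eq_zero(2)[OF B star_annihilators[OF B b] c])
    then show "c * (a * b)\<^sup>\<star> = 0"
      by (simp add: star_mult flip: mult.assoc)
  qed
qed

section \<open>Central annihilators are ideals\<close>

lemma annihilator_central_iff_splits: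
  assumes "B \<in> annihilators"
  shows "ortho_central (Abs_annihilator B) \<longleftrightarrow>
    (\<forall>T\<in>annihilators. T \<subseteq> ann (ann ((T \<inter> B) \<union> (T \<inter> ann B))))"
proof -
  have "ortho_central (Abs_annihilator B) \<longleftrightarrow>
    (\<forall>t. Rep_annihilator t \<subseteq>
      ann (ann ((Rep_annihilator t \<inter> B) \<union> (Rep_annihilator t \<inter> ann B))))"
    using assms
    by (simp add: ortho_central_iff_splits less_eq_annihilator.rep_eq sup_annihilator.rep_eq
        inf_annihilator.rep_eq uminus_annihilator.rep_eq Abs_annihilator_inverse)
  also have "\<dots> \<longleftrightarrow> (\<forall>T\<in>annihilators. T \<subseteq> ann (ann ((T \<inter> B) \<union> (T \<inter> ann B))))"
    by (simp flip: type_definition.Rep_range[OF type_definition_annihilator])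
  finally show ?thesis .
qed

theorem theorem3p30:
  fixes B :: "'a::cstar_algebra set"
  assumes "B \<in> annihilators"
  shows "ortho_central (Abs_annihilator B) \<longleftrightarrow> two_sided_ideal B"
  unfolding annihilator_central_iff_splits[OF assms]
  using ideal_splits[OF _ assms] splits_imp_ideal[OF assms] by blast

end
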